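(* Let $(X,\delta)$ be a complete metrically star-shaped hemi-metric space and let $T:X\to X$ be non-expansive, i.e. $\delta(T(x),T(y))\leq\delta(x,y)$ for all $x,y\in X$. Then $$\inf_{y\in X}\delta(y,T(y))=\rho(T)=\max_{h}\ \inf_{x\in X}\big(h(T(x))-h(x)\big),$$ where $\rho(T)=\lim_{k\to\infty}\delta(x,T^k(x))/k$ and where the maximum, which is attained, is taken over the set $\mathscr{M}$ of Martin functions $h$ of $(X,\delta)$. If in addition the hemi-metric $\delta$ is bounded from below (in particular, if $\delta$ is a metric), and if $\rho(T)>0$, then any function attaining the maximum is a horofunction.
   Context: A hemi-metric on a set $X$ is a map $\delta:X\times X\to\mathbb{R}$ (not necessarily symmetric or non-negative) such that for all $x,y,z\in X$: (1) $\delta(x,z)\leq\delta(x,y)+\delta(y,z)$; (2) $\delta(x,y)=\delta(y,x)=0$ if and only if $x=y$. Then $d(x,y)=\max(\delta(x,y),\delta(y,x))$ is a metric on $X$; the topology of $X$ is the one induced by $d$, and $(X,\delta)$ is called complete if $(X,d)$ is complete. A geodesic joining $x\in X$ to $y\in X$ is a map $\gamma:[0,1]\to X$ with $\gamma(0)=x$, $\gamma(1)=y$ and $\delta(\gamma(s),\gamma(t))=(t-s)\delta(x,y)$ for all $0\leq s\leq t\leq 1$. $(X,\delta)$ is metrically star-shaped with centre $x^\circ\in X$ if there is a family of geodesics $\{\gamma_y\}_{y\in X}$, with $\gamma_y$ joining $x^\circ$ to $y$, such that $\delta(\gamma_y(s),\gamma_z(s))\leq s\,\delta(y,z)$ for all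 $y,z\in X$, $s\in[0,1]$; if $\delta$ is not a metric, it is also required that for every $y\in X$, $\delta(y,\gamma_y(s))\to0$ as $s\to1$. It is metrically star-shaped if this holds for some centre. For a non-expansive map $T$, the limit $\rho(T)=\lim_{k\to\infty}\delta(x,T^k(x))/k=\inf_{k\geq1}\delta(x,T^k(x))/k$ (the linear escape rate) exists by subadditivity, and $\rho(T)$ does not depend on $x\in X$. Fix a basepoint $\bar x\in X$. For $x\in X$ define $i(x):X\to\mathbb{R}$ by $[i(x)](y)=\delta(\bar x,x)-\delta(y,x)$. The Martin space $\mathscr{M}$ is the closure of $i(X)=\{i(x)\mid x\in X\}$ in $\mathbb{R}^X$ for the topology of pointwise convergence (it is compact); its elements are called Martin functions. The elements of $\mathscr{H}=\mathscr{M}\setminus i(X)$ are called horofunctions. Changing the basepoint only adds a constant to each Martin function. *)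

theory Defs
  imports "HOL-Analysis.Analysis"
begin

locale Hemi_metric =
  fixes X :: "'a set" and \<delta> :: "'a \<Rightarrow> 'a \<Rightarrow> real"
  assumes triangle: "\<lbrakk>x \<in> X; y \<in> X; z \<in> X\<rbrakk> \<Longrightarrow> \<delta> x z \<le> \<delta> x y + \<delta> y z"
    and zero: "\<lbrakk>x \<in> X; y \<in> X\<rbrakk> \<Longrightarrow> (\<delta> x y = 0 \<and> \<delta> y x = 0) \<longleftrightarrow> x = y"

(* The library locale Metric_space demands symmetry and non-negativity on the whole type,
   not only on the carrier, so values off the carrier are normalized to 0. *)
definition on_carrier :: "'a set \<Rightarrow> ('a \<Rightarrow> 'a \<Rightarrow> real) \<Rightarrow> 'a \<Rightarrow> 'a \<Rightarrow> real" where
  "on_carrier X f x y = (if x \<in> X \<and> y \<in> X then f x y else 0)"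

definition is_metric :: "'a set \<Rightarrow> ('a \<Rightarrow> 'a \<Rightarrow> real) \<Rightarrow> bool" where
  "is_metric X \<delta> \<longleftrightarrow> Metric_space X (on_carrier X \<delta>)"

definition sym_dist :: "'a set \<Rightarrow> ('a \<Rightarrow> 'a \<Rightarrow> real) \<Rightarrow> 'a \<Rightarrow> 'a \<Rightarrow> real" where
  "sym_dist X \<delta> = on_carrier X (\<lambda>x y. max (\<delta> x y) (\<delta> y x))"

lemma (in Hemi_metric) Metric_space_sym_dist: "Metric_space X (sym_dist X \<delta>)"
proof
  show "0 \<le> sym_dist X \<delta> x y" for x y
    using triangle[of x y x] zero[of x x] by (auto simp: sym_dist_def on_carrier_def)
  show "sym_dist X \<delta> x y = sym_dist X \<delta> y x" for x y
    by (auto simp: sym_dist_def on_carrier_def)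
  show "sym_dist X \<delta> x y = 0 \<longleftrightarrow> x = y" if "x \<in> X" "y \<in> X" for x y
    using that triangle[of x y x] triangle[of y x y] zero[of x y] zero[of x x] zero[of y y]
    by (auto simp: sym_dist_def on_carrier_def max_def split: if_splits)
  show "sym_dist X \<delta> x z \<le> sym_dist X \<delta> x y + sym_dist X \<delta> y z"
    if "x \<in> X" "y \<in> X" "z \<in> X" for x y z
    using that triangle[of x y z] triangle[of z y x] by (auto simp: sym_dist_def on_carrier_def)
qed

definition hemi_complete :: "'a set \<Rightarrow> ('a \<Rightarrow> 'a \<Rightarrow> real) \<Rightarrow> bool" where
  "hemi_complete X \<delta> \<longleftrightarrow> Metric_space.mcomplete X (sym_dist X \<delta>)"

definition hemi_geodesic ::
  "'a set \<Rightarrow> ('a \<Rightarrow> 'a \<Rightarrow> real) \<Rightarrow> 'a \<Rightarrow> 'a \<Rightarrow> (real \<Rightarrow> 'a) \<Rightarrow> bool" where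
  "hemi_geodesic X \<delta> x y \<gamma> \<longleftrightarrow>
     \<gamma> \<in> {0..1} \<rightarrow> X \<and> \<gamma> 0 = x \<and> \<gamma> 1 = y \<and>
     (\<forall>s t. 0 \<le> s \<and> s \<le> t \<and> t \<le> 1 \<longrightarrow> \<delta> (\<gamma> s) (\<gamma> t) = (t - s) * \<delta> x y)"

definition star_shaped_at :: "'a set \<Rightarrow> ('a \<Rightarrow> 'a \<Rightarrow> real) \<Rightarrow> 'a \<Rightarrow> bool" where
  "star_shaped_at X \<delta> c \<longleftrightarrow> c \<in> X \<and>
     (\<exists>\<gamma> :: 'a \<Rightarrow> real \<Rightarrow> 'a.
        (\<forall>y\<in>X. hemi_geodesic X \<delta> c y (\<gamma> y)) \<and>
        (\<forall>y\<in>X. \<forall>z\<in>X. \<forall>s\<in>{0..1}. \<delta> (\<gamma> y s) (\<gamma> z s) \<le> s * \<delta> y z) \<and>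
        (\<not> is_metric X \<delta> \<longrightarrow> (\<forall>y\<in>X. ((\<lambda>s. \<delta> y (\<gamma> y s)) \<longlongrightarrow> 0) (at_left 1))))"

definition star_shaped :: "'a set \<Rightarrow> ('a \<Rightarrow> 'a \<Rightarrow> real) \<Rightarrow> bool" where
  "star_shaped X \<delta> \<longleftrightarrow> (\<exists>c. star_shaped_at X \<delta> c)"

definition non_expansive :: "'a set \<Rightarrow> ('a \<Rightarrow> 'a \<Rightarrow> real) \<Rightarrow> ('a \<Rightarrow> 'a) \<Rightarrow> bool" where
  "non_expansive X \<delta> T \<longleftrightarrow> T \<in> X \<rightarrow> X \<and> (\<forall>x\<in>X. \<forall>y\<in>X. \<delta> (T x) (T y) \<le> \<delta> x y)"

definition escape_rate :: "'a set \<Rightarrow> ('a \<Rightarrow> 'a \<Rightarrow> real) \<Rightarrow> ('a \<Rightarrow> 'a) \<Rightarrow> real" where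
  "escape_rate X \<delta> T =
     (THE r. \<forall>x\<in>X. (\<lambda>k. \<delta> x ((T ^^ k) x) / real k) \<longlonglongrightarrow> r)"

(* Real-valued functions on X are represented by functions that are undefined off X;
   these form the topological space of the product topology below. *)
definition martin_embed :: "'a set \<Rightarrow> ('a \<Rightarrow> 'a \<Rightarrow> real) \<Rightarrow> 'a \<Rightarrow> 'a \<Rightarrow> 'a \<Rightarrow> real" where
  "martin_embed X \<delta> b x = (\<lambda>y\<in>X. \<delta> b x - \<delta> y x)"

definition martin_space :: "'a set \<Rightarrow> ('a \<Rightarrow> 'a \<Rightarrow> real) \<Rightarrow> 'a \<Rightarrow> ('a \<Rightarrow> real) set" where
  "martin_space X \<delta> b =
     product_topology (\<lambda>_. euclideanreal) X closure_of (martin_embed X \<delta> b ` X)"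

definition horofunctions :: "'a set \<Rightarrow> ('a \<Rightarrow> 'a \<Rightarrow> real) \<Rightarrow> 'a \<Rightarrow> ('a \<Rightarrow> real) set" where
  "horofunctions X \<delta> b = martin_space X \<delta> b - martin_embed X \<delta> b ` X"

(* The infimum may be minus infinity, e.g. for T x = - x and h x = x on the real line. *)
definition min_drift :: "'a set \<Rightarrow> ('a \<Rightarrow> 'a) \<Rightarrow> ('a \<Rightarrow> real) \<Rightarrow> ereal" where
  "min_drift X T h = (INF x\<in>X. ereal (h (T x) - h x))"

definition bounded_from_below :: "'a set \<Rightarrow> ('a \<Rightarrow> 'a \<Rightarrow> real) \<Rightarrow> bool" where
  "bounded_from_below X \<delta> \<longleftrightarrow> (\<exists>c. \<forall>x\<in>X. \<forall>y\<in>X. c \<le> \<delta> x y)"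

lemma is_metric_bounded_from_below:
  assumes "is_metric X \<delta>"
  shows "bounded_from_below X \<delta>"
proof -
  have "0 \<le> \<delta> x y" if "x \<in> X" "y \<in> X" for x y
    using Metric_space.nonneg[OF assms[unfolded is_metric_def], of x y] that
    by (simp add: on_carrier_def)
  then show ?thesis
    unfolding bounded_from_below_def by blast
qed

end

theory Submission
  imports Defs
begin

text \<open>
Write \<open>\<ell>\<close> for the minimal displacement \<open>inf\<^sub>y \<delta>(y, T y)\<close>. Everything follows from squeezing
\<open>\<delta>(x, T\<^sup>k x) / k\<close> between the drift \<open>inf\<^sub>x (h(T x) - h(x))\<close> of a Martin
function \<open>h\<close> and a displacement.

Martin functions are 1-Lipschitz for \<open>\<delta>\<close>, because the functions \<open>i(x)\<close> are and pointwise limits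
preserve this. In particular \<open>h(T y) - h(y) \<le> \<delta>(y, T y)\<close>, so no drift exceeds \<open>\<ell>\<close>. Conversely,
suppose that some Martin function \<open>h\<close> has drift at least \<open>\<ell>\<close>. Telescoping along the orbit gives
\<open>k \<ell> \<le> h(T\<^sup>k x) - h(x) \<le> \<delta>(x, T\<^sup>k x)\<close>, while for every \<open>y\<close> the distance \<open>\<delta>(x, T\<^sup>k x)\<close> exceeds
\<open>k \<delta>(y, T y)\<close> by at most the constant \<open>\<delta>(x, y) + \<delta>(y, x)\<close>. Hence
\<open>\<delta>(x, T\<^sup>k x) / k \<longlonglongrightarrow> \<ell>\<close>: the existence of the limit and its value come together.

Such a function is produced by a discount argument. For \<open>0 < s < 1\<close> the map
\<open>x \<mapsto> \<gamma>\<^bsub>T x\<^esub>(s)\<close> contracts the symmetrised metric by the factor \<open>s\<close>, so by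
completeness it has a fixed point \<open>y\<^sub>s\<close>. As \<open>y\<^sub>s\<close> lies on the geodesic from the centre to
\<open>T y\<^sub>s\<close>, the quantity \<open>(1 - s) \<delta>(c, y\<^sub>s)\<close> equals \<open>s \<delta>(y\<^sub>s, T y\<^sub>s) \<ge> s \<ell>\<close>, and this makes the
increment of \<open>i(y\<^sub>s)\<close> from \<open>x\<close> to \<open>T x\<close> at least \<open>\<ell> - o(1)\<close> as \<open>s \<rightarrow> 1\<close>, for each
fixed \<open>x\<close> (\<open>discounted_fixed_point_drift\<close>). The Martin space is compact, so some Martin
function has all its increments at least \<open>\<ell>\<close> (\<open>Martin_function_of_maximal_drift\<close>).

Finally, a function \<open>i(z)\<close> of positive drift would have \<open>\<delta>(T\<^sup>k x, z)\<close> tend to minus infinity, which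
is impossible when \<open>\<delta>\<close> is bounded from below.
\<close>

section \<open>Hemi-metrics and Martin functions\<close>

lemma linear_growth_le:
  fixes a b C :: real
  assumes "\<And>k::nat. real k * a \<le> real k * b + C"
  shows "a \<le> b"
proof (rule ccontr)
  assume "\<not> a \<le> b"
  then obtain k :: nat where "C < real k * (a - b)"
    using reals_Archimedean3[of "a - b"] by auto
  with assms[of k] show False
    by (simp add: algebra_simps)
qed

context Hemi_metric
begin

lemma diag_zero: "x \<in> X \<Longrightarrow> \<delta> x x = 0"
  using zero by blast

abbreviation "pointwise \<equiv> product_topology (\<lambda>_::'a. euclideanreal) X"

lemma closedin_increment:
  assumes "x \<in> X" "y \<in> X" "closed S"
  shows "closedin pointwise {h \<in> topspace pointwise. h y - h x \<in> S}"
  by (rule closedin_continuous_map_preimage[where Y = euclideanreal])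
    (use assms in \<open>auto intro!: continuous_intros\<close>)

lemma Martin_function_Lipschitz:
  assumes h: "h \<in> martin_space X \<delta> b" and b: "b \<in> X" and x: "x \<in> X" and y: "y \<in> X"
  shows "h y - h x \<le> \<delta> x y"
proof -
  have "martin_embed X \<delta> b ` X \<subseteq> {h \<in> topspace pointwise. h y - h x \<in> {..\<delta> x y}}"
    using triangle[OF x y] x y by (fastforce simp: martin_embed_def)
  from closure_of_minimal[OF this closedin_increment[OF x y]] h show ?thesis
    by (auto simp: martin_space_def)
qed

lemma martin_embed_in_martin_space:
  assumes "x \<in> X"
  shows "martin_embed X \<delta> b x \<in> martin_space X \<delta> b"
proof -
  have "martin_embed X \<delta> b ` X \<subseteq> topspace pointwise"
    by (auto simp: martin_embed_def)
  from closure_of_subset[OF this] assms show ?thesis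
    by (auto simp: martin_space_def)
qed

text \<open>By the triangle inequality, every \<open>i(x)\<close> lies in the box with sides
  \<open>[- \<delta>(y, b), \<delta>(b, y)]\<close>, which is compact by Tychonoff's theorem.\<close>

lemma compactin_martin_space:
  assumes b: "b \<in> X"
  shows "compactin pointwise (martin_space X \<delta> b)"
proof -
  let ?B = "\<Pi>\<^sub>E y\<in>X. {- \<delta> y b..\<delta> b y}"
  have "closedin pointwise ?B"
    by (simp add: closedin_product_topology)
  moreover have "martin_embed X \<delta> b ` X \<subseteq> ?B"
    using triangle b by (fastforce simp: martin_embed_def)
  ultimately have "martin_space X \<delta> b \<subseteq> ?B"
    unfolding martin_space_def by (intro closure_of_minimal)
  moreover have "compactin pointwise ?B"
    by (simp add: compactin_PiE)
  ultimately show ?thesis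
    by (auto intro: closed_compactin simp: martin_space_def)
qed

end

section \<open>Orbits of non-expansive maps\<close>

locale Nonexpansive_map = Hemi_metric +
  fixes T :: "'a \<Rightarrow> 'a"
  assumes nonexpansive: "non_expansive X \<delta> T"
begin

lemma T_in: "x \<in> X \<Longrightarrow> T x \<in> X"
  using nonexpansive by (auto simp: non_expansive_def)

lemma T_le: "x \<in> X \<Longrightarrow> y \<in> X \<Longrightarrow> \<delta> (T x) (T y) \<le> \<delta> x y"
  using nonexpansive by (auto simp: non_expansive_def)

lemma orbit_in: "x \<in> X \<Longrightarrow> (T ^^ k) x \<in> X"
  by (induction k) (auto simp: T_in)

lemma orbit_nonexpansive:
  assumes "x \<in> X" "y \<in> X"
  shows "\<delta> ((T ^^ k) x) ((T ^^ k) y) \<le> \<delta> x y"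
proof (induction k)
  case (Suc k)
  show ?case
    using T_le[of "(T ^^ k) x" "(T ^^ k) y"] orbit_in assms Suc by fastforce
qed simp

lemma orbit_le_own_displacement:
  assumes x: "x \<in> X"
  shows "\<delta> x ((T ^^ k) x) \<le> real k * \<delta> x (T x)"
proof (induction k)
  case 0
  show ?case by (simp add: diag_zero x)
next
  case (Suc k)
  have "\<delta> x ((T ^^ Suc k) x) \<le> \<delta> x ((T ^^ k) x) + \<delta> ((T ^^ k) x) ((T ^^ k) (T x))"
    using triangle[of x "(T ^^ k) x" "(T ^^ k) (T x)"] x
    by (simp add: orbit_in T_in funpow_swap1)
  also have "\<dots> \<le> real k * \<delta> x (T x) + \<delta> x (T x)"
    using orbit_nonexpansive x T_in Suc by (intro add_mono) auto
  finally show ?case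
    by (simp add: algebra_simps)
qed

text \<open>Going from \<open>x\<close> to the orbit of \<open>y\<close>, along it, and back costs only a constant, because
  \<open>T\<^sup>k\<close> does not increase the final distance \<open>\<delta>(y, x)\<close>. So every displacement bounds the
  growth rate of every orbit.\<close>

lemma orbit_le_displacement:
  assumes x: "x \<in> X" and y: "y \<in> X"
  shows "\<delta> x ((T ^^ k) x) \<le> real k * \<delta> y (T y) + (\<delta> x y + \<delta> y x)"
proof -
  have "\<delta> x ((T ^^ k) x) \<le> \<delta> x y + (\<delta> y ((T ^^ k) y) + \<delta> ((T ^^ k) y) ((T ^^ k) x))"
    using triangle[of x y "(T ^^ k) x"] triangle[of y "(T ^^ k) y" "(T ^^ k) x"]
    by (simp add: orbit_in x y)
  then show ?thesis
    using orbit_le_own_displacement[OF y] orbit_nonexpansive[OF y x, of k] by (smt (verit))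
qed

text \<open>The reversed orbit also grows at most linearly, and \<open>0 = \<delta>(x, x) \<le> \<delta>(x, T\<^sup>k x) + \<delta>(T\<^sup>k x, x)\<close>
  turns this into a lower bound.\<close>

lemma orbit_ge:
  assumes x: "x \<in> X"
  shows "- (real k * \<delta> (T x) x) \<le> \<delta> x ((T ^^ k) x)"
proof -
  have "\<delta> ((T ^^ k) x) x \<le> real k * \<delta> (T x) x"
  proof (induction k)
    case 0
    show ?case by (simp add: diag_zero x)
  next
    case (Suc k)
    have "\<delta> ((T ^^ Suc k) x) x \<le> \<delta> ((T ^^ k) (T x)) ((T ^^ k) x) + \<delta> ((T ^^ k) x) x"
      using triangle[of "(T ^^ k) (T x)" "(T ^^ k) x" x] x
      by (simp add: orbit_in T_in funpow_swap1)
    also have "\<dots> \<le> \<delta> (T x) x + real k * \<delta> (T x) x"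
      using orbit_nonexpansive x T_in Suc by (intro add_mono) auto
    finally show ?case
      by (simp add: algebra_simps)
  qed
  then show ?thesis
    using triangle[of x "(T ^^ k) x" x] by (simp add: orbit_in x diag_zero)
qed

text \<open>Since \<open>\<delta>\<close> may be negative, the displacements could a priori have infimum minus
  infinity. This is excluded because \<open>\<delta>(x, T\<^sup>k x) \<ge> - k \<delta>(T x, x)\<close>, while a displacement \<open>\<delta>(y, T y)\<close> below
  \<open>- \<delta>(T x, x)\<close> would push \<open>\<delta>(x, T\<^sup>k x)\<close> under this bound for large \<open>k\<close>.\<close>

lemma bdd_below_displacement: "bdd_below ((\<lambda>y. \<delta> y (T y)) ` X)"
proof (cases "X = {}")
  case False
  then obtain x where x: "x \<in> X" by blast
  have "- \<delta> (T x) x \<le> \<delta> y (T y)" if y: "y \<in> X" for y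
  proof (rule linear_growth_le)
    show "real k * - \<delta> (T x) x \<le> real k * \<delta> y (T y) + (\<delta> x y + \<delta> y x)" for k
      using orbit_ge[OF x, of k] orbit_le_displacement[OF x y, of k] by simp
  qed
  then show ?thesis by (rule bdd_belowI2)
qed simp

lemma drift_along_orbit:
  assumes drift: "\<And>x. x \<in> X \<Longrightarrow> \<mu> \<le> h (T x) - h x" and x: "x \<in> X"
  shows "real k * \<mu> \<le> h ((T ^^ k) x) - h x"
proof (induction k)
  case (Suc k)
  then show ?case
    using drift[OF orbit_in[OF x, of k]] by (simp add: algebra_simps)
qed simp

lemma drift_le_orbit:
  assumes "h \<in> martin_space X \<delta> b" "b \<in> X"
    and "\<And>x. x \<in> X \<Longrightarrow> \<mu> \<le> h (T x) - h x" and x: "x \<in> X"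
  shows "real k * \<mu> \<le> \<delta> x ((T ^^ k) x)"
  using drift_along_orbit[of \<mu> h x k] Martin_function_Lipschitz[of h b x "(T ^^ k) x"]
    orbit_in assms by fastforce

definition min_displacement :: real where
  "min_displacement = (INF y\<in>X. \<delta> y (T y))"

lemma min_displacement_le: "y \<in> X \<Longrightarrow> min_displacement \<le> \<delta> y (T y)"
  unfolding min_displacement_def by (rule cINF_lower[OF bdd_below_displacement])

lemma le_min_displacement:
  assumes "X \<noteq> {}" "\<And>y. y \<in> X \<Longrightarrow> \<mu> \<le> \<delta> y (T y)"
  shows "\<mu> \<le> min_displacement"
  unfolding min_displacement_def using assms by (rule cINF_greatest)

lemma ereal_INF_displacement:
  assumes "X \<noteq> {}"
  shows "(INF y\<in>X. ereal (\<delta> y (T y))) = ereal min_displacement"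
proof (rule antisym)
  show "ereal min_displacement \<le> (INF y\<in>X. ereal (\<delta> y (T y)))"
    by (rule INF_greatest) (simp add: min_displacement_le)
  show "(INF y\<in>X. ereal (\<delta> y (T y))) \<le> ereal min_displacement"
  proof (rule ereal_le_epsilon2)
    fix e :: real assume "0 < e"
    then obtain y where "y \<in> X" "\<delta> y (T y) < min_displacement + e"
      using cINF_less_iff[OF assms bdd_below_displacement, of "min_displacement + e"]
      by (auto simp: min_displacement_def)
    then show "(INF y\<in>X. ereal (\<delta> y (T y))) \<le> ereal min_displacement + ereal e"
      by (intro INF_lower2[of y]) auto
  qed
qed

lemma min_drift_le:
  assumes h: "h \<in> martin_space X \<delta> b" and b: "b \<in> X"
  shows "min_drift X T h \<le> ereal min_displacement"
proof (cases "min_drift X T h")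
  case (real r)
  have "r \<le> h (T x) - h x" if "x \<in> X" for x
    using INF_lower[OF that, of "\<lambda>x. ereal (h (T x) - h x)"] real by (simp add: min_drift_def)
  then have "r \<le> \<delta> y (T y)" if "y \<in> X" for y
    using Martin_function_Lipschitz[OF h b that T_in[OF that]] that by fastforce
  with b real show ?thesis
    by (auto intro: le_min_displacement)
next
  case PInf
  then show ?thesis
    using INF_lower[OF b, of "\<lambda>x. ereal (h (T x) - h x)"] by (simp add: min_drift_def)
qed simp

section \<open>Discounted fixed points and a Martin function of maximal drift\<close>

text \<open>Here \<open>g\<close> stands for \<open>y \<mapsto> \<gamma>\<^bsub>y\<^esub>(s)\<close>. The composite with \<open>T\<close> inherits
  the factor \<open>s\<close> in both directions of \<open>\<delta>\<close>, hence in the symmetrised metric.\<close>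

lemma discounted_fixed_point:
  assumes "hemi_complete X \<delta>" "X \<noteq> {}" and s: "0 \<le> s" "s < 1"
    and g_in: "\<And>y. y \<in> X \<Longrightarrow> g y \<in> X"
    and g_le: "\<And>y z. y \<in> X \<Longrightarrow> z \<in> X \<Longrightarrow> \<delta> (g y) (g z) \<le> s * \<delta> y z"
  obtains y where "y \<in> X" "g (T y) = y"
proof -
  interpret M: Metric_space X "sym_dist X \<delta>"
    by (rule Metric_space_sym_dist)
  have *: "\<delta> (g (T x)) (g (T y)) \<le> s * sym_dist X \<delta> x y"
    "\<delta> (g (T x)) (g (T y)) \<le> s * sym_dist X \<delta> y x" if "x \<in> X" "y \<in> X" for x y
  proof -
    have "\<delta> (g (T x)) (g (T y)) \<le> s * \<delta> (T x) (T y)"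
      by (simp add: g_le T_in that)
    also have "\<dots> \<le> s * sym_dist X \<delta> x y"
      using T_le[OF that] that
      by (intro mult_left_mono s) (simp add: sym_dist_def on_carrier_def)
    finally show "\<delta> (g (T x)) (g (T y)) \<le> s * sym_dist X \<delta> x y" .
    then show "\<delta> (g (T x)) (g (T y)) \<le> s * sym_dist X \<delta> y x"
      by (simp add: M.commute)
  qed
  have "sym_dist X \<delta> (g (T x)) (g (T y)) \<le> s * sym_dist X \<delta> x y" if "x \<in> X" "y \<in> X" for x y
  proof -
    have "sym_dist X \<delta> (g (T x)) (g (T y))
        = max (\<delta> (g (T x)) (g (T y))) (\<delta> (g (T y)) (g (T x)))"
      by (simp add: sym_dist_def on_carrier_def g_in T_in that)
    then show ?thesis
      using *(1)[OF that] *(2)[OF that(2,1)] by simp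
  qed
  moreover have "M.mcomplete"
    using assms(1) by (simp add: hemi_complete_def)
  ultimately show thesis
    using M.Banach_fixedpoint_thm[of "\<lambda>x. g (T x)" s thesis] g_in T_in assms(2) s(2) that
    by auto
qed

text \<open>Two effects combine. The contraction estimate between the geodesics to \<open>T x\<close> and \<open>T y\<close> gives
  \<open>\<delta>(T x, y) \<le> \<delta>(T x, \<gamma>\<^bsub>T x\<^esub>(s)) + s \<delta>(x, y)\<close>, so the increment is at least \<open>(1 - s) \<delta>(x, y)\<close> up
  to the first term. Although \<open>1 - s\<close> is small, this product need not be: moving \<open>x\<close> to the centre
  changes it to \<open>(1 - s) \<delta>(c, y)\<close> at a cost of \<open>(1 - s) \<delta>(c, x)\<close>, and the fixed point
  property identifies \<open>(1 - s) \<delta>(c, y)\<close> with \<open>s \<delta>(y, T y)\<close>.\<close>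

lemma discounted_fixed_point_drift:
  assumes s: "0 \<le> s" "s \<le> 1" and c: "c \<in> X"
    and geod: "\<And>y. y \<in> X \<Longrightarrow> hemi_geodesic X \<delta> c y (\<gamma> y)"
    and \<gamma>_le: "\<And>y z. y \<in> X \<Longrightarrow> z \<in> X \<Longrightarrow> \<delta> (\<gamma> y s) (\<gamma> z s) \<le> s * \<delta> y z"
    and y: "y \<in> X" "\<gamma> (T y) s = y" and x: "x \<in> X"
  shows "s * min_displacement - (1 - s) * \<delta> c x - \<delta> (T x) (\<gamma> (T x) s) \<le> \<delta> x y - \<delta> (T x) y"
proof -
  have geod_eq: "\<delta> (\<gamma> (T y) u) (\<gamma> (T y) t) = (t - u) * \<delta> c (T y)"
    if "0 \<le> u" "u \<le> t" "t \<le> 1" for u t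
    using geod[OF T_in[OF y(1)]] that by (simp add: hemi_geodesic_def)
  have ends: "\<gamma> (T y) 0 = c" "\<gamma> (T y) 1 = T y"
    using geod[OF T_in[OF y(1)]] by (simp_all add: hemi_geodesic_def)
  have \<gamma>_in: "\<gamma> (T x) s \<in> X"
    using geod[OF T_in[OF x]] s by (auto simp: hemi_geodesic_def)
  have "\<delta> c y = s * \<delta> c (T y)" "\<delta> y (T y) = (1 - s) * \<delta> c (T y)"
    using geod_eq[of 0 s] geod_eq[of s 1] ends y(2) s by auto
  then have "s * \<delta> y (T y) = (1 - s) * \<delta> c y"
    by simp
  moreover have "s * min_displacement \<le> s * \<delta> y (T y)"
    by (intro mult_left_mono min_displacement_le y s)
  moreover have "(1 - s) * \<delta> c y \<le> (1 - s) * (\<delta> c x + \<delta> x y)"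
    using triangle[OF c x y(1)] s by (intro mult_left_mono) auto
  moreover have "\<delta> (T x) y \<le> \<delta> (T x) (\<gamma> (T x) s) + s * \<delta> x y"
  proof -
    have "\<delta> (T x) y \<le> \<delta> (T x) (\<gamma> (T x) s) + \<delta> (\<gamma> (T x) s) (\<gamma> (T y) s)"
      using triangle[OF T_in[OF x] \<gamma>_in y(1)] y(2) by simp
    moreover have "\<delta> (\<gamma> (T x) s) (\<gamma> (T y) s) \<le> s * \<delta> (T x) (T y)"
      by (intro \<gamma>_le T_in x y)
    moreover have "s * \<delta> (T x) (T y) \<le> s * \<delta> x y"
      by (intro mult_left_mono T_le x y s)
    ultimately show ?thesis by simp
  qed
  ultimately show ?thesis
    by (simp add: algebra_simps)
qed

end

context Hemi_metric
begin

text \<open>For a metric, continuity of the geodesics at their end point in the backward direction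
  is a consequence of symmetry, so it holds in either case of the definition.\<close>

lemma star_shaped_at_geodesics:
  assumes "star_shaped_at X \<delta> c"
  obtains \<gamma> where "\<And>y. y \<in> X \<Longrightarrow> hemi_geodesic X \<delta> c y (\<gamma> y)"
    "\<And>y z s. y \<in> X \<Longrightarrow> z \<in> X \<Longrightarrow> 0 \<le> s \<Longrightarrow> s \<le> 1 \<Longrightarrow> \<delta> (\<gamma> y s) (\<gamma> z s) \<le> s * \<delta> y z"
    "\<And>y. y \<in> X \<Longrightarrow> ((\<lambda>s. \<delta> y (\<gamma> y s)) \<longlongrightarrow> 0) (at_left 1)"
proof -
  obtain \<gamma> where geod: "\<forall>y\<in>X. hemi_geodesic X \<delta> c y (\<gamma> y)"
    and le: "\<forall>y\<in>X. \<forall>z\<in>X. \<forall>s\<in>{0..1}. \<delta> (\<gamma> y s) (\<gamma> z s) \<le> s * \<delta> y z"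
    and lim: "\<not> is_metric X \<delta> \<longrightarrow> (\<forall>y\<in>X. ((\<lambda>s. \<delta> y (\<gamma> y s)) \<longlongrightarrow> 0) (at_left 1))"
    using assms unfolding star_shaped_at_def by blast
  have "((\<lambda>s. \<delta> y (\<gamma> y s)) \<longlongrightarrow> 0) (at_left 1)" if y: "y \<in> X" for y
  proof (cases "is_metric X \<delta>")
    case True
    have sym: "\<delta> u v = \<delta> v u" if "u \<in> X" "v \<in> X" for u v
      using Metric_space.commute[OF True[unfolded is_metric_def], of u v] that
      by (simp add: on_carrier_def)
    have backward: "(1 - s) * \<delta> c y = \<delta> y (\<gamma> y s)" if s: "s \<in> {0<..<1}" for s
    proof -
      have g: "hemi_geodesic X \<delta> c y (\<gamma> y)"
        using geod y by blast
      have geod_eq: "\<delta> (\<gamma> y u) (\<gamma> y t) = (t - u) * \<delta> c y" if "0 \<le> u" "u \<le> t" "t \<le> 1" for u t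
        using g that by (simp add: hemi_geodesic_def)
      have "\<gamma> y s \<in> X"
        using g s by (auto simp: hemi_geodesic_def)
      moreover have "\<delta> (\<gamma> y s) (\<gamma> y 1) = (1 - s) * \<delta> c y"
        using geod_eq[of s 1] s by simp
      moreover have "\<gamma> y 1 = y"
        using g by (simp add: hemi_geodesic_def)
      ultimately show ?thesis
        using sym[OF y, of "\<gamma> y s"] by simp
    qed
    have "eventually (\<lambda>s. s \<in> {0<..<1}) (at_left (1::real))"
      by (rule eventually_at_left_real) simp
    then have "eventually (\<lambda>s. (1 - s) * \<delta> c y = \<delta> y (\<gamma> y s)) (at_left 1)"
      by (rule eventually_mono) (rule backward)
    moreover have "((\<lambda>s. (1 - s) * \<delta> c y) \<longlongrightarrow> (1 - 1) * \<delta> c y) (at_left 1)"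
      by (intro tendsto_intros)
    ultimately show ?thesis
      using Lim_transform_eventually[of "\<lambda>s. (1 - s) * \<delta> c y" 0 "at_left 1" "\<lambda>s. \<delta> y (\<gamma> y s)"]
      by simp
  qed (use lim y in blast)
  then show thesis
    using geod le by (intro that[of \<gamma>]) simp_all
qed

end

context Nonexpansive_map
begin

text \<open>By compactness it suffices to satisfy finitely many constraints
  \<open>h(T x) - h(x) \<ge> \<ell> - \<epsilon>\<close> at a time, and \<open>i(y\<^sub>s)\<close> satisfies these once \<open>s\<close> is close enough to 1.\<close>

lemma Martin_function_of_maximal_drift:
  assumes "hemi_complete X \<delta>" "star_shaped X \<delta>" and b: "b \<in> X"
  obtains h where "h \<in> martin_space X \<delta> b" "\<And>x. x \<in> X \<Longrightarrow> min_displacement \<le> h (T x) - h x"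
proof -
  let ?M = "martin_space X \<delta> b" and ?l = min_displacement
  obtain c where "star_shaped_at X \<delta> c"
    using assms(2) by (auto simp: star_shaped_def)
  then have c: "c \<in> X"
    by (simp add: star_shaped_at_def)
  obtain \<gamma> where geod: "\<And>y. y \<in> X \<Longrightarrow> hemi_geodesic X \<delta> c y (\<gamma> y)"
    and \<gamma>_le: "\<And>y z s. y \<in> X \<Longrightarrow> z \<in> X \<Longrightarrow> 0 \<le> s \<Longrightarrow> s \<le> 1 \<Longrightarrow> \<delta> (\<gamma> y s) (\<gamma> z s) \<le> s * \<delta> y z"
    and \<gamma>_lim: "\<And>y. y \<in> X \<Longrightarrow> ((\<lambda>s. \<delta> y (\<gamma> y s)) \<longlongrightarrow> 0) (at_left 1)"
    using star_shaped_at_geodesics[OF \<open>star_shaped_at X \<delta> c\<close>] by blast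
  define low where "low = (\<lambda>x s. s * ?l - (1 - s) * \<delta> c x - \<delta> (T x) (\<gamma> (T x) s))"
  have low_lim: "(low x \<longlongrightarrow> ?l) (at_left 1)" if "x \<in> X" for x
    unfolding low_def by (auto intro!: tendsto_eq_intros \<gamma>_lim T_in that)
  define D where "D = (\<lambda>(x, e). {h \<in> topspace pointwise. h (T x) - h x \<in> {?l - e..}})"
  let ?\<U> = "D ` (X \<times> {0<..})"
  have "?M \<inter> \<Inter>\<F> \<noteq> {}" if fin: "finite \<F>" "\<F> \<subseteq> ?\<U>" for \<F>
  proof -
    obtain P where P: "finite P" "P \<subseteq> X \<times> {0<..}" "\<F> = D ` P"
      using finite_subset_image[OF fin] by metis
    have "eventually (\<lambda>s. ?l - e < low x s) (at_left 1)" if "(x, e) \<in> P" for x e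
      using P(2) that by (intro order_tendstoD(1)[OF low_lim]) auto
    then have "\<forall>p\<in>P. eventually (\<lambda>s. ?l - snd p < low (fst p) s) (at_left 1)"
      by simp
    with P(1) have "eventually (\<lambda>s. \<forall>p\<in>P. ?l - snd p < low (fst p) s) (at_left 1)"
      by (rule eventually_ball_finite)
    moreover have "eventually (\<lambda>s. s \<in> {0<..<1}) (at_left (1::real))"
      by (rule eventually_at_left_real) simp
    ultimately have "eventually (\<lambda>s. (\<forall>p\<in>P. ?l - snd p < low (fst p) s) \<and> s \<in> {0<..<1}) (at_left 1)"
      by (rule eventually_conj)
    from eventually_happens'[OF trivial_limit_at_left_real this]
    obtain s where s: "0 < s" "s < 1" and low: "\<forall>p\<in>P. ?l - snd p < low (fst p) s"
      by auto
    have "\<gamma> y s \<in> X" if "y \<in> X" for y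
      using geod[OF that] s by (auto simp: hemi_geodesic_def)
    then obtain y where y: "y \<in> X" "\<gamma> (T y) s = y"
      using discounted_fixed_point[OF assms(1), of s "\<lambda>y. \<gamma> y s"] \<gamma>_le s b
      by auto
    let ?h = "martin_embed X \<delta> b y"
    have "?h \<in> D (x, e)" if "(x, e) \<in> P" for x e
    proof -
      have x: "x \<in> X" using that P(2) by auto
      have "low x s \<le> \<delta> x y - \<delta> (T x) y"
        unfolding low_def using s
        by (intro discounted_fixed_point_drift c geod \<gamma>_le y x) auto
      moreover have "?l - e < low x s"
        using low that by force
      ultimately show ?thesis
        by (auto simp: D_def martin_embed_def x T_in)
    qed
    then have "?h \<in> ?M \<inter> \<Inter>\<F>"
      using martin_embed_in_martin_space[OF y(1)] P(3) by auto
    then show ?thesis by blast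
  qed
  moreover have "closedin pointwise C" if "C \<in> ?\<U>" for C
    using that closedin_increment[OF _ T_in closed_atLeast]
    by (auto simp: D_def simp del: topspace_product_topology)
  ultimately have "?M \<inter> \<Inter>?\<U> \<noteq> {}"
    using compactin_martin_space[OF b] unfolding compactin_fip by blast
  then obtain h where h: "h \<in> ?M" "\<And>x e. x \<in> X \<Longrightarrow> 0 < e \<Longrightarrow> h \<in> D (x, e)"
    by auto
  have "?l \<le> h (T x) - h x" if "x \<in> X" for x
  proof (rule field_le_epsilon)
    show "?l \<le> h (T x) - h x + e" if "0 < e" for e
      using h(2)[OF \<open>x \<in> X\<close> that] by (simp add: D_def)
  qed
  with h(1) show thesis by (rule that)
qed

section \<open>The escape rate\<close>

text \<open>The drift bounds the quotient from below for every \<open>k\<close>; from above, a point \<open>y\<close> of almost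
  minimal displacement does so for large \<open>k\<close>.\<close>

lemma orbit_rate_tendsto:
  assumes h: "h \<in> martin_space X \<delta> b" "b \<in> X"
    and drift: "\<And>x. x \<in> X \<Longrightarrow> min_displacement \<le> h (T x) - h x"
    and x: "x \<in> X"
  shows "(\<lambda>k. \<delta> x ((T ^^ k) x) / real k) \<longlonglongrightarrow> min_displacement"
proof (rule LIMSEQ_I)
  fix e :: real assume e: "0 < e"
  obtain y where y: "y \<in> X" "\<delta> y (T y) < min_displacement + e / 2"
    using cINF_less_iff[OF _ bdd_below_displacement, of "min_displacement + e / 2"] e x
    by (auto simp: min_displacement_def)
  define C where "C = \<delta> x y + \<delta> y x"
  obtain N :: nat where N: "C < real N * (e / 2)"
    using reals_Archimedean3[of "e / 2"] e by auto
  have "norm (\<delta> x ((T ^^ k) x) / real k - min_displacement) < e" if k: "Suc N \<le> k" for k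
  proof -
    have k0: "0 < real k" using k by simp
    have "real k * min_displacement \<le> \<delta> x ((T ^^ k) x)"
      using drift_le_orbit[of h b min_displacement x k] h drift x by blast
    then have lower: "min_displacement \<le> \<delta> x ((T ^^ k) x) / real k"
      using k0 by (simp add: field_simps)
    have "\<delta> x ((T ^^ k) x) \<le> real k * \<delta> y (T y) + C"
      unfolding C_def by (rule orbit_le_displacement[OF x y(1)])
    also have "\<dots> < real k * (min_displacement + e / 2) + real k * (e / 2)"
    proof (rule add_strict_mono)
      show "real k * \<delta> y (T y) < real k * (min_displacement + e / 2)"
        using k0 y(2) by simp
      have "real N * (e / 2) \<le> real k * (e / 2)"
        using k e by (intro mult_right_mono) auto
      with N show "C < real k * (e / 2)" by linarith
    qed
    finally have "\<delta> x ((T ^^ k) x) / real k < min_displacement + e"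
      using k0 by (simp add: field_simps)
    with lower show ?thesis by simp
  qed
  then show "\<exists>N. \<forall>k\<ge>N. norm (\<delta> x ((T ^^ k) x) / real k - min_displacement) < e"
    by blast
qed

lemma escape_rate_eqI:
  assumes "X \<noteq> {}" "\<And>x. x \<in> X \<Longrightarrow> (\<lambda>k. \<delta> x ((T ^^ k) x) / real k) \<longlonglongrightarrow> r"
  shows "escape_rate X \<delta> T = r"
  unfolding escape_rate_def using assms by (intro the_equality) (auto intro: LIMSEQ_unique)

text \<open>If \<open>h = i(z)\<close>, then \<open>h\<close> is bounded above as soon as \<open>\<delta>\<close> is bounded from below, whereas a
  positive drift makes \<open>h\<close> unbounded along every orbit.\<close>

lemma positive_drift_imp_horofunction:
  assumes h: "h \<in> martin_space X \<delta> b" and b: "b \<in> X" and "bounded_from_below X \<delta>"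
    and \<mu>: "0 < \<mu>" and drift: "\<And>x. x \<in> X \<Longrightarrow> \<mu> \<le> h (T x) - h x"
  shows "h \<in> horofunctions X \<delta> b"
proof -
  have False if z: "z \<in> X" and hz: "h = martin_embed X \<delta> b z" for z
  proof -
    obtain c where c: "\<And>x y. x \<in> X \<Longrightarrow> y \<in> X \<Longrightarrow> c \<le> \<delta> x y"
      using assms(3) by (auto simp: bounded_from_below_def)
    have "real k * \<mu> \<le> real k * 0 + (\<delta> b z - c)" for k
    proof -
      have "real k * \<mu> \<le> \<delta> b z - \<delta> ((T ^^ k) b) z"
        using drift_along_orbit[of \<mu> h b k, OF drift b] b orbit_in[OF b, of k]
        by (simp add: hz martin_embed_def)
      with c[OF orbit_in[OF b] z, of k] show ?thesis by simp
    qed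
    then have "\<mu> \<le> 0" by (rule linear_growth_le)
    with \<mu> show False by simp
  qed
  with h show ?thesis
    by (auto simp: horofunctions_def)
qed

end

theorem theorem1:
  fixes X :: "'a set" and \<delta> :: "'a \<Rightarrow> 'a \<Rightarrow> real" and T :: "'a \<Rightarrow> 'a" and b :: 'a
  assumes "Hemi_metric X \<delta>"
    and "hemi_complete X \<delta>"
    and "star_shaped X \<delta>"
    and "non_expansive X \<delta> T"
    and "b \<in> X"
  shows "(\<forall>x\<in>X. (\<lambda>k. \<delta> x ((T ^^ k) x) / real k) \<longlonglongrightarrow> escape_rate X \<delta> T) \<and>
    (INF y\<in>X. ereal (\<delta> y (T y))) = ereal (escape_rate X \<delta> T) \<and>
    (\<exists>h\<in>martin_space X \<delta> b. min_drift X T h = ereal (escape_rate X \<delta> T)) \<and>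
    (\<forall>h\<in>martin_space X \<delta> b. min_drift X T h \<le> ereal (escape_rate X \<delta> T)) \<and>
    (bounded_from_below X \<delta> \<and> escape_rate X \<delta> T > 0 \<longrightarrow>
       (\<forall>h\<in>martin_space X \<delta> b.
          min_drift X T h = ereal (escape_rate X \<delta> T) \<longrightarrow> h \<in> horofunctions X \<delta> b))"
proof -
  interpret Nonexpansive_map X \<delta> T
    using assms by (simp add: Nonexpansive_map_def Nonexpansive_map_axioms_def)
  have ne: "X \<noteq> {}" using assms(5) by blast
  obtain h where h: "h \<in> martin_space X \<delta> b"
    and drift: "\<And>x. x \<in> X \<Longrightarrow> min_displacement \<le> h (T x) - h x"
    using Martin_function_of_maximal_drift[OF assms(2,3,5)] by blast
  have lim: "(\<lambda>k. \<delta> x ((T ^^ k) x) / real k) \<longlonglongrightarrow> min_displacement" if "x \<in> X" for x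
    using orbit_rate_tendsto[of h b x] h assms(5) drift that by blast
  have rate: "escape_rate X \<delta> T = min_displacement"
    using ne lim by (rule escape_rate_eqI)
  have "ereal min_displacement \<le> min_drift X T h"
    unfolding min_drift_def by (intro INF_greatest) (simp add: drift)
  then have attained: "min_drift X T h = ereal min_displacement"
    by (intro antisym min_drift_le[OF h assms(5)])
  have horo: "k \<in> horofunctions X \<delta> b"
    if "bounded_from_below X \<delta>" "0 < min_displacement" "k \<in> martin_space X \<delta> b"
      "min_drift X T k = ereal min_displacement" for k
  proof (rule positive_drift_imp_horofunction[OF that(3) assms(5) that(1,2)])
    show "min_displacement \<le> k (T x) - k x" if "x \<in> X" for x
      using INF_lower[OF that, of "\<lambda>x. ereal (k (T x) - k x)"]
        \<open>min_drift X T k = ereal min_displacement\<close>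
      by (simp add: min_drift_def)
  qed
  show ?thesis
    unfolding rate
    using lim ereal_INF_displacement[OF ne] h attained min_drift_le[OF _ assms(5)] horo by blast
qed

end
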